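(* Let $\mathbf{G}$ and $\mathbf{\Delta}$ be (causal) linear time-invariant operators of dimension $n$, i.e. acting from sequences in $\mathbb{R}^n$ to sequences in $\mathbb{R}^n$, and let $\lambda$ be a real number such that $\|\mathbf{\Delta}\|_{\mathcal{L}_1}\le\lambda<1$ and $\|\mathbf{G}\|_{\mathcal{H}_2}<\infty$. Then $$\left\|\mathbf{G}(\mathbf{I}-\mathbf{\Delta})^{-1}\right\|_{\mathcal{H}_2}\le\|\mathbf{G}\|_{2\leftarrow1}\,\frac{n}{1-\lambda}.$$
   Context: A causal linear time-invariant operator $\mathbf{\Phi}$ of dimension $n$ is given by a sequence of matrices $(\Phi_k)_{k\ge0}$ in $\mathbb{R}^{n\times n}$ and acts on sequences $\mathbf{w}=(w_0,w_1,\dots)$ in $\mathbb{R}^n$ by the convolution $(\mathbf{\Phi}\mathbf{w})_t=\sum_{k=0}^{t}\Phi_k w_{t-k}$. Products of operators are compositions, $\mathbf{I}$ is the identity operator, and $(\mathbf{I}-\mathbf{\Delta})^{-1}$ is the inverse operator, which exists as a bounded operator on $\ell_1$ because $\|\mathbf{\Delta}\|_{\mathcal{L}_1}<1$. For sequences, writing $w_{i,t}$ for the $i$-th entry of $w_t$, $\|\mathbf{w}\|_1=\sum_{t\ge0}\sum_{i=1}^n|w_{i,t}|$ and $\|\mathbf{w}\|_2=\big(\sum_{t\ge0}\sum_{i=1}^n|w_{i,t}|^2\big)^{1/2}$. The norms of operators are: $\|\mathbf{\Phi}\|_{\mathcal{H}_2}=\big(\sum_{k\ge0}\|\Phi_k\|_F^2\big)^{1/2}$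 (with $\|\cdot\|_F$ the Frobenius norm); $\|\mathbf{\Phi}\|_{\mathcal{L}_1}=\sup_{\|\mathbf{w}\|_1\le1}\|\mathbf{\Phi}\mathbf{w}\|_1$, the induced $\ell_1\to\ell_1$ norm, equal to the maximum over $i$ of the $\ell_1$ norm $\sum_{k\ge0}\|\Phi_ke_i\|_1$ of the $i$-th column; and $\|\mathbf{\Phi}\|_{2\leftarrow1}=\sup_{\|\mathbf{w}\|_1\le1}\|\mathbf{\Phi}\mathbf{w}\|_2$. *)

theory Defs
  imports "HOL-Analysis.Analysis"
begin

type_synonym 'n signal = "nat \<Rightarrow> real ^ 'n"
type_synonym 'n operator = "'n signal \<Rightarrow> 'n signal"

definition convolve :: "(nat \<Rightarrow> real ^ 'n ^ 'n) \<Rightarrow> 'n::finite operator" where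
  "convolve \<Phi> w = (\<lambda>t. \<Sum>k\<le>t. \<Phi> k *v w (t - k))"

text \<open>Operators are maps on arbitrary signals, not only on summable ones, so that products are
  function compositions and inverses are inverse functions.\<close>

definition causal_lti :: "'n::finite operator \<Rightarrow> bool" where
  "causal_lti T \<longleftrightarrow> (\<exists>\<Phi>. T = convolve \<Phi>)"

text \<open>The matrix sequence \<open>\<Phi>\<close> of a causal LTI operator. It is determined by the operator, see
  \<open>impulse_response_convolve\<close> below; on other operators it is unspecified.\<close>

definition impulse_response :: "'n::finite operator \<Rightarrow> nat \<Rightarrow> real ^ 'n ^ 'n" where
  "impulse_response T = (THE \<Phi>. T = convolve \<Phi>)"

lemma convolve_impulse:
  "convolve \<Phi> (\<lambda>s. if s = 0 then v else 0) t = \<Phi> t *v v"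
proof -
  have "convolve \<Phi> (\<lambda>s. if s = 0 then v else 0) t
      = (\<Sum>k\<le>t. if k = t then \<Phi> k *v v else 0)"
    unfolding convolve_def by (rule sum.cong) auto
  then show ?thesis by simp
qed

lemma inj_convolve: "inj convolve"
proof (rule injI)
  fix \<Phi> \<Psi> :: "nat \<Rightarrow> real ^ 'n ^ 'n"
  assume "convolve \<Phi> = convolve \<Psi>"
  then have "\<Phi> t *v v = \<Psi> t *v v" for t v
    by (metis convolve_impulse)
  then show "\<Phi> = \<Psi>"
    by (simp add: fun_eq_iff matrix_eq)
qed

lemma impulse_response_convolve: "impulse_response (convolve \<Phi>) = \<Phi>"
  unfolding impulse_response_def using inj_convolve by (auto dest: injD)

text \<open>All norms take values in the extended reals, where a divergent series has the value
  \<open>\<infinity>\<close>.\<close>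

definition ereal_sqrt :: "ereal \<Rightarrow> ereal" where
  "ereal_sqrt x = (if x = \<infinity> then \<infinity> else ereal (sqrt (real_of_ereal x)))"

definition l1_norm :: "'n::finite signal \<Rightarrow> ereal" where
  "l1_norm w = (\<Sum>t. ereal (\<Sum>i\<in>UNIV. \<bar>w t $ i\<bar>))"

definition l2_norm :: "'n::finite signal \<Rightarrow> ereal" where
  "l2_norm w = ereal_sqrt (\<Sum>t. ereal (\<Sum>i\<in>UNIV. \<bar>w t $ i\<bar>\<^sup>2))"

definition frobenius_norm :: "real ^ 'n ^ 'm \<Rightarrow> real" where
  "frobenius_norm A = sqrt (\<Sum>i\<in>UNIV. \<Sum>j\<in>UNIV. (A $ i $ j)\<^sup>2)"

definition H2_norm :: "'n::finite operator \<Rightarrow> ereal" where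
  "H2_norm T = ereal_sqrt (\<Sum>k. ereal ((frobenius_norm (impulse_response T k))\<^sup>2))"

definition L1_norm :: "'n::finite operator \<Rightarrow> ereal" where
  "L1_norm T = (SUP w\<in>{w. l1_norm w \<le> 1}. l1_norm (T w))"

definition norm_2_1 :: "'n::finite operator \<Rightarrow> ereal" where
  "norm_2_1 T = (SUP w\<in>{w. l1_norm w \<le> 1}. l2_norm (T w))"

end

theory Submission
  imports Defs
begin

text \<open>The \<open>j\<close>-th column of the impulse response of \<open>G (I - \<Delta>)\<^sup>-\<^sup>1\<close> is \<open>G w\<close>, where \<open>w\<close> solves
  \<open>w = e\<^sub>j + \<Delta> w\<close> for the unit impulse \<open>e\<^sub>j\<close>. By causality the truncations of \<open>w\<close> to a finite
  horizon satisfy \<open>\<parallel>w\<parallel>\<^sub>1 \<le> 1 + \<lambda> \<parallel>w\<parallel>\<^sub>1\<close>, hence \<open>\<parallel>w\<parallel>\<^sub>1 \<le> 1 / (1 - \<lambda>)\<close> and the column has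
  \<open>\<ell>\<^sub>2\<close> norm at most \<open>\<parallel>G\<parallel>\<^bsub>2\<leftarrow>1\<^esub> / (1 - \<lambda>)\<close>. Summing the squares of the \<open>n\<close> columns gives the bound
  even with \<open>sqrt n\<close> in place of \<open>n\<close>.\<close>

section \<open>Extended-real norm bounds as bounds on all partial sums\<close>

lemma suminf_ereal_le_iff:
  fixes f :: "nat \<Rightarrow> real"
  assumes "\<And>t. 0 \<le> f t"
  shows "(\<Sum>t. ereal (f t)) \<le> ereal x \<longleftrightarrow> (\<forall>N. (\<Sum>t<N. f t) \<le> x)"
proof
  assume *: "(\<Sum>t. ereal (f t)) \<le> ereal x"
  show "\<forall>N. (\<Sum>t<N. f t) \<le> x"
  proof
    fix N
    have "(\<Sum>t<N. ereal (f t)) \<le> (\<Sum>t. ereal (f t))"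
      using assms by (intro suminf_upper) auto
    then show "(\<Sum>t<N. f t) \<le> x"
      using * by (metis ereal_less_eq(3) order_trans sum_ereal)
  qed
next
  assume "\<forall>N. (\<Sum>t<N. f t) \<le> x"
  then show "(\<Sum>t. ereal (f t)) \<le> ereal x"
    using assms by (intro suminf_bound) auto
qed

lemma ereal_sqrt_le_iff:
  assumes "0 \<le> a" "0 \<le> x"
  shows "ereal_sqrt a \<le> ereal x \<longleftrightarrow> a \<le> ereal (x\<^sup>2)"
  using assms by (cases a) (auto simp: ereal_sqrt_def intro: real_le_lsqrt sqrt_le_D)

lemma ereal_sqrt_suminf_le_iff:
  fixes f :: "nat \<Rightarrow> real"
  assumes "\<And>t. 0 \<le> f t" "0 \<le> x"
  shows "ereal_sqrt (\<Sum>t. ereal (f t)) \<le> ereal x \<longleftrightarrow> (\<forall>N. (\<Sum>t<N. f t) \<le> x\<^sup>2)"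
proof -
  have "0 \<le> (\<Sum>t. ereal (f t))"
    using assms by (intro suminf_0_le) auto
  then show ?thesis
    using assms by (simp add: ereal_sqrt_le_iff suminf_ereal_le_iff)
qed

section \<open>Algebra of convolution operators\<close>

lemma convolve_cong:
  assumes "\<And>s. s \<le> t \<Longrightarrow> v s = w s"
  shows "convolve \<Phi> v t = convolve \<Phi> w t"
  unfolding convolve_def using assms by simp

lemma convolve_scaleR: "convolve \<Phi> (\<lambda>t. c *\<^sub>R w t) = (\<lambda>t. c *\<^sub>R convolve \<Phi> w t)"
  unfolding convolve_def
  by (simp add: scaleR_sum_right linear_cmul[OF matrix_vector_mul_linear])

lemma convolve_diff: "convolve \<Phi> (v - w) = convolve \<Phi> v - convolve \<Phi> w"
  unfolding convolve_def by (simp add: fun_eq_iff matrix_vector_mult_diff_distrib sum_subtractf)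

lemma convolve_zero: "convolve \<Phi> (\<lambda>_. 0) t = 0"
  by (simp add: convolve_def)

lemma sum_matrix_vector_mult:
  fixes A :: "'i \<Rightarrow> real ^ 'n ^ 'm"
  shows "(\<Sum>i\<in>I. A i) *v x = (\<Sum>i\<in>I. A i *v x)"
  by (induction I rule: infinite_finite_induct) (simp_all add: matrix_vector_mult_add_rdistrib)

text \<open>Impulse responses multiply as in a Cauchy product: the double sum over
  \<open>k + l \<le> t\<close> is regrouped by \<open>m = k + l\<close>.\<close>

lemma convolve_comp:
  fixes \<Phi> \<Psi> :: "nat \<Rightarrow> real ^ 'n ^ 'n::finite"
  shows "convolve \<Phi> \<circ> convolve \<Psi> = convolve (\<lambda>t. \<Sum>k\<le>t. \<Phi> k ** \<Psi> (t - k))"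
proof (intro ext)
  fix w :: "'n signal" and t
  have "(\<Sum>k\<le>t. \<Phi> k *v (\<Sum>l\<le>t - k. \<Psi> l *v w (t - k - l)))
      = (\<Sum>k\<le>t. \<Sum>l\<le>t - k. (\<Phi> k ** \<Psi> l) *v w (t - (k + l)))"
    by (simp add: linear_sum[OF matrix_vector_mul_linear] matrix_vector_mul_assoc)
  also have "\<dots> = (\<Sum>(k, l)\<in>(SIGMA k:{..t}. {..t - k}). (\<Phi> k ** \<Psi> l) *v w (t - (k + l)))"
    by (subst sum.Sigma) auto
  also have "(SIGMA k:{..t}. {..t - k}) = {(k, l). k + l \<le> t}"
    by auto
  also have "(\<Sum>(k, l)\<in>\<dots>. (\<Phi> k ** \<Psi> l) *v w (t - (k + l)))
      = (\<Sum>m\<le>t. \<Sum>k\<le>m. (\<Phi> k ** \<Psi> (m - k)) *v w (t - (k + (m - k))))"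
    by (rule sum.triangle_reindex_eq)
  also have "\<dots> = (\<Sum>m\<le>t. (\<Sum>k\<le>m. \<Phi> k ** \<Psi> (m - k)) *v w (t - m))"
    by (simp add: sum_matrix_vector_mult)
  finally show "(convolve \<Phi> \<circ> convolve \<Psi>) w t
      = convolve (\<lambda>t. \<Sum>k\<le>t. \<Phi> k ** \<Psi> (t - k)) w t"
    by (simp add: convolve_def)
qed

section \<open>Norm estimates over finite horizons\<close>

text \<open>By causality the outputs before time \<open>N\<close> depend only on the inputs before
  \<open>N\<close>. So \<open>w\<close> can be cut off at \<open>N\<close> and normalised, which
  makes it admissible in the supremum even if \<open>w\<close> is not summable.\<close>

lemma L1_norm_truncation:
  fixes w :: "'n::finite signal"
  assumes "L1_norm (convolve \<Phi>) \<le> ereal lam"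
  shows "(\<Sum>t<N. \<Sum>i\<in>UNIV. \<bar>convolve \<Phi> w t $ i\<bar>) \<le> lam * (\<Sum>t<N. \<Sum>i\<in>UNIV. \<bar>w t $ i\<bar>)"
proof -
  define s where "s = (\<Sum>t<N. \<Sum>i\<in>UNIV. \<bar>w t $ i\<bar>)"
  have "s \<ge> 0"
    unfolding s_def by (intro sum_nonneg) auto
  show ?thesis
  proof (cases "s = 0")
    \<comment> \<open>Normalisation by \<open>s\<close> is impossible here, but the inputs before
      \<open>N\<close> vanish and hence so do the outputs.\<close>
    case True
    then have "w t = 0" if "t < N" for t
      using that unfolding s_def
      by (simp add: sum_nonneg_eq_0_iff sum_nonneg vec_eq_iff)
    then have "convolve \<Phi> w t = 0" if "t < N" for t
      using convolve_cong[of t w "\<lambda>_. 0" \<Phi>] that by (simp add: convolve_zero)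
    then show ?thesis
      using True by (simp add: s_def)
  next
    case False
    with \<open>s \<ge> 0\<close> have "s > 0" by simp
    define u where "u = (\<lambda>t. if t < N then (1 / s) *\<^sub>R w t else 0)"
    have "(\<Sum>t<M. \<Sum>i\<in>UNIV. \<bar>u t $ i\<bar>) \<le> 1" for M
    proof -
      have "(\<Sum>t<M. \<Sum>i\<in>UNIV. \<bar>u t $ i\<bar>) = (\<Sum>t\<in>{..<M} \<inter> {..<N}. \<Sum>i\<in>UNIV. \<bar>u t $ i\<bar>)"
        by (intro sum.mono_neutral_right) (auto simp: u_def)
      also have "\<dots> \<le> (\<Sum>t<N. \<Sum>i\<in>UNIV. \<bar>u t $ i\<bar>)"
        by (intro sum_mono2) (auto simp: sum_nonneg)
      also have "\<dots> = s / s"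
        using \<open>s > 0\<close> by (simp add: u_def s_def[symmetric] abs_mult sum_divide_distrib[symmetric])
      finally show ?thesis
        using \<open>s > 0\<close> by simp
    qed
    then have "l1_norm u \<le> 1"
      by (simp add: l1_norm_def one_ereal_def suminf_ereal_le_iff sum_nonneg)
    then have "l1_norm (convolve \<Phi> u) \<le> L1_norm (convolve \<Phi>)"
      unfolding L1_norm_def by (intro SUP_upper) simp
    then have "l1_norm (convolve \<Phi> u) \<le> ereal lam"
      using assms by (rule order_trans)
    then have "(\<Sum>t<N. \<Sum>i\<in>UNIV. \<bar>convolve \<Phi> u t $ i\<bar>) \<le> lam"
      by (simp add: l1_norm_def suminf_ereal_le_iff sum_nonneg)
    \<comment> \<open>The cut-off is invisible before time \<open>N\<close>.\<close>
    moreover have "convolve \<Phi> u t = (1 / s) *\<^sub>R convolve \<Phi> w t" if "t < N" for t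
    proof -
      have "convolve \<Phi> u t = convolve \<Phi> (\<lambda>t. (1 / s) *\<^sub>R w t) t"
        using that by (intro convolve_cong) (simp add: u_def)
      then show ?thesis
        by (simp only: convolve_scaleR)
    qed
    ultimately have "(\<Sum>t<N. \<Sum>i\<in>UNIV. \<bar>convolve \<Phi> w t $ i\<bar>) / s \<le> lam"
      using \<open>s > 0\<close> by (simp add: abs_mult sum_divide_distrib)
    then show ?thesis
      using \<open>s > 0\<close> by (simp add: s_def[symmetric] pos_divide_le_eq)
  qed
qed

text \<open>Scaling by a positive bound \<open>c\<close> on the partial sums, rather than by the
  norm of \<open>w\<close>, makes the signal admissible in the supremum without a separate zero
  case.\<close>

lemma norm_2_1_bound:
  fixes w :: "'n::finite signal"
  assumes norm: "norm_2_1 (convolve \<Phi>) \<le> ereal m" "0 \<le> m"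
    and w: "\<And>N. (\<Sum>t<N. \<Sum>i\<in>UNIV. \<bar>w t $ i\<bar>) \<le> c" and "0 < c"
  shows "(\<Sum>t<N. \<Sum>i\<in>UNIV. (convolve \<Phi> w t $ i)\<^sup>2) \<le> (m * c)\<^sup>2"
proof -
  define u where "u = (\<lambda>t. (1 / c) *\<^sub>R w t)"
  have "(\<Sum>t<N. \<Sum>i\<in>UNIV. \<bar>u t $ i\<bar>) \<le> 1" for N
  proof -
    have "(\<Sum>t<N. \<Sum>i\<in>UNIV. \<bar>u t $ i\<bar>) = (\<Sum>t<N. \<Sum>i\<in>UNIV. \<bar>w t $ i\<bar>) / c"
      using \<open>0 < c\<close> by (simp add: u_def abs_mult sum_divide_distrib)
    then show ?thesis
      using w[of N] \<open>0 < c\<close> by simp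
  qed
  then have "l1_norm u \<le> 1"
    by (simp add: l1_norm_def one_ereal_def suminf_ereal_le_iff sum_nonneg)
  then have "l2_norm (convolve \<Phi> u) \<le> norm_2_1 (convolve \<Phi>)"
    unfolding norm_2_1_def by (intro SUP_upper) simp
  then have "l2_norm (convolve \<Phi> u) \<le> ereal m"
    using norm(1) by (rule order_trans)
  then have "(\<Sum>t<N. \<Sum>i\<in>UNIV. (convolve \<Phi> u t $ i)\<^sup>2) \<le> m\<^sup>2"
    using \<open>0 \<le> m\<close> by (simp add: l2_norm_def ereal_sqrt_suminf_le_iff sum_nonneg)
  moreover have "(\<Sum>t<N. \<Sum>i\<in>UNIV. (convolve \<Phi> u t $ i)\<^sup>2)
      = (\<Sum>t<N. \<Sum>i\<in>UNIV. (convolve \<Phi> w t $ i)\<^sup>2) / c\<^sup>2"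
    by (simp add: u_def convolve_scaleR power_divide sum_divide_distrib)
  ultimately show ?thesis
    using \<open>0 < c\<close> by (simp add: pos_divide_le_eq power_mult_distrib)
qed

section \<open>The inverse of \<open>id - convolve \<Phi>\<close>\<close>

lemma matrix_inv_right:
  assumes "invertible A"
  shows "A ** matrix_inv A = mat 1"
  using someI_ex[OF assms[unfolded invertible_def]] by (simp add: matrix_inv_def)

lemma matrix_diff_rdistrib:
  fixes A B :: "'a::ring_1 ^ 'n ^ 'm"
  shows "(A - B) ** C = A ** C - B ** C"
  by (simp add: matrix_matrix_mult_def vec_eq_iff left_diff_distrib sum_subtractf)

text \<open>The coefficients of the solution \<open>R\<close> of \<open>R = I + \<Phi> R\<close>. At
  time \<open>t\<close> the only summand containing the unknown \<open>R t\<close> is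
  \<open>\<Phi> 0 ** R t\<close>; moving it to the left leaves the factor
  \<open>mat 1 - \<Phi> 0\<close> to invert. Unlike a Neumann series, this recursion raises no
  question of convergence.\<close>

fun resolvent :: "(nat \<Rightarrow> real ^ 'n ^ 'n) \<Rightarrow> nat \<Rightarrow> real ^ 'n ^ 'n::finite" where
  "resolvent \<Phi> t = matrix_inv (mat 1 - \<Phi> 0) **
     ((if t = 0 then mat 1 else 0) + (\<Sum>k<t. \<Phi> (t - k) ** resolvent \<Phi> k))"

declare resolvent.simps [simp del]

text \<open>A kernel vector is fixed by \<open>\<Phi> 0\<close>, which contracts the l1 norm by the
  factor \<open>lam < 1\<close>, so it is zero.\<close>

lemma invertible_one_minus_impulse_response:
  assumes "L1_norm (convolve \<Phi>) \<le> ereal lam" "lam < 1"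
  shows "invertible (mat 1 - \<Phi> 0)"
proof -
  have "v = 0" if "(mat 1 - \<Phi> 0) *v v = 0" for v
  proof -
    have "\<Phi> 0 *v v = v"
      using that by (simp add: matrix_vector_mult_diff_rdistrib)
    then have "(\<Sum>i\<in>UNIV. \<bar>v $ i\<bar>) \<le> lam * (\<Sum>i\<in>UNIV. \<bar>v $ i\<bar>)"
      \<comment> \<open>The horizon \<open>N = 1\<close> sees time 0 only, where the convolution is
        just \<open>\<Phi> 0 *v v\<close>; the later values of the signal are irrelevant.\<close>
      using L1_norm_truncation[OF assms(1), where N = 1 and w = "\<lambda>_. v"]
      by (simp add: convolve_def)
    then have "(1 - lam) * (\<Sum>i\<in>UNIV. \<bar>v $ i\<bar>) \<le> 0"
      by (simp add: algebra_simps)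
    then have "(\<Sum>i\<in>UNIV. \<bar>v $ i\<bar>) \<le> 0"
      using \<open>lam < 1\<close> by (simp add: mult_le_0_iff)
    then have "(\<Sum>i\<in>UNIV. \<bar>v $ i\<bar>) = 0"
      by (simp add: sum_nonneg antisym)
    then show "v = 0"
      by (simp add: sum_nonneg_eq_0_iff vec_eq_iff)
  qed
  then show ?thesis
    by (simp add: invertible_left_inverse matrix_left_invertible_ker)
qed

lemma convolve_resolvent:
  assumes "invertible (mat 1 - \<Phi> 0)"
  shows "convolve (resolvent \<Phi>) w t = w t + convolve \<Phi> (convolve (resolvent \<Phi>) w) t"
proof -
  have "resolvent \<Phi> t = (if t = 0 then mat 1 else 0) + (\<Sum>k\<le>t. \<Phi> k ** resolvent \<Phi> (t - k))" for t
  proof -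
    have "(mat 1 - \<Phi> 0) ** resolvent \<Phi> t
        = (if t = 0 then mat 1 else 0) + (\<Sum>k<t. \<Phi> (t - k) ** resolvent \<Phi> k)"
      by (subst resolvent.simps) (simp add: matrix_mul_assoc matrix_inv_right[OF assms])
    then have "resolvent \<Phi> t = (if t = 0 then mat 1 else 0)
        + ((\<Sum>k<t. \<Phi> (t - k) ** resolvent \<Phi> k) + \<Phi> 0 ** resolvent \<Phi> t)"
      by (simp add: matrix_diff_rdistrib algebra_simps)
    also have "(\<Sum>k<t. \<Phi> (t - k) ** resolvent \<Phi> k) + \<Phi> 0 ** resolvent \<Phi> t
        = (\<Sum>k\<le>t. \<Phi> (t - k) ** resolvent \<Phi> k)"
      by (simp add: lessThan_Suc_atMost[symmetric])
    also have "\<dots> = (\<Sum>k\<le>t. \<Phi> k ** resolvent \<Phi> (t - k))"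
      by (rule sum.reindex_bij_witness[of _ "\<lambda>k. t - k" "\<lambda>k. t - k"]) auto
    finally show ?thesis .
  qed
  then have *: "resolvent \<Phi>
      = (\<lambda>t. (if t = 0 then mat 1 else 0) + (\<Sum>k\<le>t. \<Phi> k ** resolvent \<Phi> (t - k)))"
    by blast
  \<comment> \<open>The sequence with \<open>mat 1\<close> at time 0 and zero elsewhere is the
    impulse response of the identity.\<close>
  have "convolve (\<lambda>t. (if t = 0 then mat 1 else 0) + \<Psi> t) w t = w t + convolve \<Psi> w t" for \<Psi>
  proof -
    have "(\<Sum>k\<le>t. (if k = 0 then mat 1 else 0) *v w (t - k)) = (\<Sum>k\<le>t. if k = 0 then w t else 0)"
      by (rule sum.cong) auto
    then show "convolve (\<lambda>t. (if t = 0 then mat 1 else 0) + \<Psi> t) w t = w t + convolve \<Psi> w t"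
      by (simp add: convolve_def matrix_vector_mult_add_rdistrib sum.distrib)
  qed
  from this[of "\<lambda>t. \<Sum>k\<le>t. \<Phi> k ** resolvent \<Phi> (t - k)"] show ?thesis
    unfolding *[symmetric] convolve_comp[symmetric] by simp
qed

text \<open>Over a finite horizon all sums are real, so \<open>lam\<close> times the sum for
  \<open>w\<close> can be moved to the left without knowing that \<open>w\<close> is summable. With
  \<open>u = 0\<close> this gives uniqueness of the solution.\<close>

lemma L1_norm_feedback_bound:
  fixes w u :: "'n::finite signal"
  assumes "L1_norm (convolve \<Phi>) \<le> ereal lam" "lam < 1"
    and w: "\<And>t. w t = u t + convolve \<Phi> w t"
  shows "(\<Sum>t<N. \<Sum>i\<in>UNIV. \<bar>w t $ i\<bar>) \<le> (\<Sum>t<N. \<Sum>i\<in>UNIV. \<bar>u t $ i\<bar>) / (1 - lam)"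
proof -
  have "(\<Sum>t<N. \<Sum>i\<in>UNIV. \<bar>w t $ i\<bar>)
      \<le> (\<Sum>t<N. \<Sum>i\<in>UNIV. \<bar>u t $ i\<bar> + \<bar>convolve \<Phi> w t $ i\<bar>)"
    by (intro sum_mono, subst w) simp
  also have "\<dots> = (\<Sum>t<N. \<Sum>i\<in>UNIV. \<bar>u t $ i\<bar>) + (\<Sum>t<N. \<Sum>i\<in>UNIV. \<bar>convolve \<Phi> w t $ i\<bar>)"
    by (simp add: sum.distrib)
  also have "\<dots> \<le> (\<Sum>t<N. \<Sum>i\<in>UNIV. \<bar>u t $ i\<bar>) + lam * (\<Sum>t<N. \<Sum>i\<in>UNIV. \<bar>w t $ i\<bar>)"
    using L1_norm_truncation[OF assms(1)] by simp
  finally show ?thesis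
    using \<open>lam < 1\<close> by (simp add: pos_le_divide_eq algebra_simps)
qed

text \<open>The resolvent equation gives the right inverse; uniqueness of its solutions gives the
  left inverse.\<close>

lemma inv_id_minus_convolve:
  assumes "L1_norm (convolve \<Phi>) \<le> ereal lam" "lam < 1"
  shows "inv (id - convolve \<Phi>) = convolve (resolvent \<Phi>)"
proof (rule inv_equality)
  let ?R = "convolve (resolvent \<Phi>)"
  have R: "?R w t = w t + convolve \<Phi> (?R w) t" for w t
    using invertible_one_minus_impulse_response[OF assms] by (rule convolve_resolvent)
  show "(id - convolve \<Phi>) (?R w) = w" for w
    using R[of w] by (simp add: fun_eq_iff)
  show "?R ((id - convolve \<Phi>) w) = w" for w
  proof -
    \<comment> \<open>Both terms solve
      \<open>x = (id - convolve \<Phi>) w + convolve \<Phi> x\<close>, so their difference solves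
      the homogeneous equation.\<close>
    define v where "v = ?R ((id - convolve \<Phi>) w) - w"
    have "v t = 0 + convolve \<Phi> v t" for t
      using R[of "(id - convolve \<Phi>) w" t]
      by (simp add: v_def convolve_diff)
    then have "(\<Sum>t<Suc t. \<Sum>i\<in>UNIV. \<bar>v t $ i\<bar>) \<le> 0" for t
      using L1_norm_feedback_bound[OF assms, of v "\<lambda>_. 0" "Suc t"] by simp
    moreover have "(\<Sum>i\<in>UNIV. \<bar>v t $ i\<bar>) \<le> (\<Sum>t<Suc t. \<Sum>i\<in>UNIV. \<bar>v t $ i\<bar>)" for t
      by (simp add: sum_nonneg)
    ultimately have "(\<Sum>i\<in>UNIV. \<bar>v t $ i\<bar>) \<le> 0" for t
      by (meson order_trans)
    then have "(\<Sum>i\<in>UNIV. \<bar>v t $ i\<bar>) = 0" for t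
      by (simp add: sum_nonneg antisym)
    then have "v t = 0" for t
      by (simp add: sum_nonneg_eq_0_iff vec_eq_iff)
    then show ?thesis
      by (simp add: v_def fun_eq_iff)
  qed
qed

section \<open>The bound on \<open>H2_norm\<close>, column by column\<close>

theorem lemma4p2:
  fixes G \<Delta> :: "'n::finite operator" and lam :: real
  assumes "causal_lti G" and "causal_lti \<Delta>"
    and "L1_norm \<Delta> \<le> ereal lam" and "lam < 1"
    and "H2_norm G < \<infinity>"
  shows "H2_norm (G \<circ> inv (id - \<Delta>)) \<le> norm_2_1 G * ereal (real CARD('n) / (1 - lam))"
proof -
  obtain g d where G: "G = convolve g" and D: "\<Delta> = convolve d"
    using assms(1,2) by (auto simp: causal_lti_def)
  note d = assms(3)[unfolded D] \<open>lam < 1\<close>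
  define c where "c = 1 / (1 - lam)"
  have "c > 0"
    using \<open>lam < 1\<close> by (simp add: c_def)
  define M where "M = (\<lambda>t. \<Sum>k\<le>t. g k ** resolvent d (t - k))"
  have comp: "G \<circ> inv (id - \<Delta>) = convolve M"
    by (simp add: G D M_def inv_id_minus_convolve[OF d] convolve_comp)
  \<comment> \<open>The zero signal is admissible in the supremum and excludes the value
    \<open>-\<infinity>\<close>.\<close>
  have "l2_norm (G (\<lambda>_. 0)) \<le> norm_2_1 G"
    unfolding norm_2_1_def by (intro SUP_upper) (simp add: l1_norm_def zero_ereal_def[symmetric])
  then have nonneg: "0 \<le> norm_2_1 G"
    by (simp add: l2_norm_def ereal_sqrt_def G convolve_zero zero_ereal_def[symmetric])
  show ?thesis
  proof (cases "norm_2_1 G")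
    case PInf
    then show ?thesis
      using \<open>lam < 1\<close> by simp
  next
    case MInf
    with nonneg show ?thesis by simp
  next
    case (real m)
    with nonneg have "m \<ge> 0" by simp
    have column: "(\<Sum>t<N. \<Sum>i\<in>UNIV. (M t $ i $ j)\<^sup>2) \<le> (m * c)\<^sup>2" for j N
    proof -
      define e :: "'n signal" where "e = (\<lambda>t. if t = 0 then axis j 1 else 0)"
      define w where "w = convolve (resolvent d) e"
      have "(\<Sum>t<N. \<Sum>i\<in>UNIV. \<bar>w t $ i\<bar>) \<le> c" for N
      proof -
        have "w t = e t + convolve d w t" for t
          unfolding w_def
          using invertible_one_minus_impulse_response[OF d] by (rule convolve_resolvent)
        then have "(\<Sum>t<N. \<Sum>i\<in>UNIV. \<bar>w t $ i\<bar>) \<le> (\<Sum>t<N. \<Sum>i\<in>UNIV. \<bar>e t $ i\<bar>) / (1 - lam)"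
          by (rule L1_norm_feedback_bound[OF d])
        also have "(\<Sum>i\<in>UNIV. \<bar>e t $ i\<bar>) = (if t = 0 then 1 else 0)" for t
          by (simp add: e_def axis_def if_distrib[of abs] cong: if_cong)
        then have "(\<Sum>t<N. \<Sum>i\<in>UNIV. \<bar>e t $ i\<bar>) / (1 - lam) \<le> 1 / (1 - lam)"
          using \<open>lam < 1\<close> by (intro divide_right_mono) auto
        finally show ?thesis
          by (simp add: c_def)
      qed
      then have "(\<Sum>t<N. \<Sum>i\<in>UNIV. (convolve g w t $ i)\<^sup>2) \<le> (m * c)\<^sup>2"
        using \<open>m \<ge> 0\<close> \<open>c > 0\<close> real by (intro norm_2_1_bound) (auto simp: G)
      moreover have "convolve g w t $ i = M t $ i $ j" for t i
      proof -
        \<comment> \<open>Composing \<open>g\<close> with the resolvent before applying it to the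
          impulse \<open>e\<close> exhibits the output as column \<open>j\<close> of
          \<open>M\<close>.\<close>
        have "convolve g w = convolve M e"
          by (simp add: w_def M_def convolve_comp[symmetric])
        then have "convolve g w t = M t *v axis j 1"
          by (simp add: e_def convolve_impulse)
        then show ?thesis
          by (simp add: matrix_vector_mult_basis column_def)
      qed
      ultimately show ?thesis by simp
    qed
    have "(\<Sum>t<N. (frobenius_norm (M t))\<^sup>2) \<le> (m * (real CARD('n) / (1 - lam)))\<^sup>2" for N
    proof -
      have "(frobenius_norm (M t))\<^sup>2 = (\<Sum>j\<in>UNIV. \<Sum>i\<in>UNIV. (M t $ i $ j)\<^sup>2)" for t
        by (subst sum.swap) (simp add: frobenius_norm_def sum_nonneg)
      then have "(\<Sum>t<N. (frobenius_norm (M t))\<^sup>2)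
          = (\<Sum>j\<in>UNIV. \<Sum>t<N. \<Sum>i\<in>UNIV. (M t $ i $ j)\<^sup>2)"
        by (simp add: sum.swap[of _ "{..<N}"])
      also have "\<dots> \<le> (\<Sum>j\<in>(UNIV :: 'n set). (m * c)\<^sup>2)"
        by (intro sum_mono column)
      also have "\<dots> = real CARD('n) * (m * c)\<^sup>2"
        by simp
      \<comment> \<open>Here the factor \<open>sqrt n\<close> is weakened to \<open>n\<close>, using
        \<open>1 \<le> CARD('n)\<close>.\<close>
      also have "\<dots> \<le> (real CARD('n))\<^sup>2 * (m * c)\<^sup>2"
        by (intro mult_right_mono self_le_power) (auto simp: Suc_le_eq)
      also have "\<dots> = (m * (real CARD('n) / (1 - lam)))\<^sup>2"
        by (simp add: c_def power_mult_distrib power_divide)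
      finally show ?thesis .
    qed
    then have "H2_norm (convolve M) \<le> ereal (m * (real CARD('n) / (1 - lam)))"
      using \<open>m \<ge> 0\<close> \<open>lam < 1\<close>
      by (simp add: H2_norm_def impulse_response_convolve ereal_sqrt_suminf_le_iff)
    then show ?thesis
      by (simp add: comp real)
  qed
qed

end
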